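(* Let $\{\epsilon_\eta\}_{\eta>0}$ and $\{\tau_\eta\}_{\eta>0}$ be positive with $\lim_{\eta\uparrow\infty}\epsilon_\eta\tau_\eta=l\in[0,\infty]$. Let $\lambda^\star=\mu^\star\in(0,1)$ with $\lambda^\star-\epsilon_\eta>0$ for all $\eta$, and consider the matching queue operating under the two-price policy $$\lambda_\eta(z)=\lambda^\star-\epsilon_\eta\mathbb{1}\{z>\tau_\eta\},\qquad \mu_\eta(z)=\mu^\star-\epsilon_\eta\mathbb{1}\{z<-\tau_\eta\},\qquad z\in\mathbb{Z},\ \eta>0,$$ with $a^c_\eta(z)\sim\operatorname{Bernoulli}(\lambda_\eta(z))$ and $a^s_\eta(z)\sim\operatorname{Bernoulli}(\mu_\eta(z))$ for all $z\in\mathbb{Z}$, $\eta>0$. Let $\bar z_\eta$ be the steady-state imbalance. Then, as $\eta\uparrow\infty$: (1) When $l=0$, $\ \epsilon_\eta\bar z_\eta\overset{D}{\to}\operatorname{Laplace}\left(0,\frac{2}{\lambda^\star(1-\lambda^\star)+\mu^\star(1-\mu^\star)}\right)$. (2) When $l\in(0,\infty)$, $\ \epsilon_\eta\bar z_\eta\overset{D}{\to}\operatorname{Hybrid}\left(\frac{2}{\lambda^\star(1-\lambda^\star)+\mu^\star(1-\mu^\star)},l\right)$ and $\ \frac{\bar z_\eta}{\tau_\eta}\overset{D}{\to}\operatorname{Hybrid}\left(\frac{2l}{\lambda^\star(1-\lambda^\star)+\mu^\star(1-\mu^\star)},1\right)$. (3) When $l=\infty$, $\ \frac{\bar z_\e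ta}{\tau_\eta}\overset{D}{\to}\operatorname{Uniform}([-1,1])$.
   Context: Matching queue: for each $\eta>0$, the imbalance is the discrete-time Markov chain on $\mathbb{Z}$ given by $z_\eta(0)=0$, $z_\eta(k+1)=z_\eta(k)+a^c_\eta(z_\eta(k),k)-a^s_\eta(z_\eta(k),k)$, $k\in\{0,1,2,\dots\}$, where all the variables $a^c_\eta(z,k),a^s_\eta(z,k)$ ($z\in\mathbb{Z}$, $k\ge0$) are mutually independent and, for each $z$ and all $k$, $a^c_\eta(z,k)$ is distributed as $a^c_\eta(z)$ and $a^s_\eta(z,k)$ as $a^s_\eta(z)$. $\bar z_\eta$ denotes a random variable with the stationary distribution of this chain. $\overset{D}{\to}$ is convergence in distribution. Asymptotic regime: as $\eta\uparrow\infty$, $\epsilon_\eta\to0$ and/or $\tau_\eta\to\infty$ (at least one holds). Distributions: $\operatorname{Laplace}(0,\lambda)$, $\lambda>0$, has density $\frac{\lambda}{2}e^{-\lambda|x|}$. $\operatorname{Hybrid}(b,c)$, $b,c>0$, has density proportional to $e^{-\int_0^xg(y)dy}$ with $g(x)=b\,\mathbb{1}\{x\ge c\}-b\,\mathbb{1}\{x\le-c\}$ (i.e. constant on $[-c,c]$ with exponential tails of rate $b$ outside). $\operatorname{Uniform}([-1,1])$ has density $\frac12\mathbb{1}\{|x|\le1\}$. *)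

theory Defs
  imports "HOL-Probability.Probability"
begin

text \<open>
  The queue is driven by independent arrivals \<open>a_c z k\<close> (customers) and \<open>a_s z k\<close> (servers), one
  pair for each state \<open>z\<close> and each time \<open>k\<close>. Their laws \<open>C z\<close> and \<open>S z\<close> do not depend on \<open>k\<close>.
  The left summand of the index type of the family below indexes customers, the right one servers.
\<close>

locale matching_queue = prob_space M
  for M :: "'a measure"
    and a_c a_s :: "int \<Rightarrow> nat \<Rightarrow> 'a \<Rightarrow> nat"
    and C S :: "int \<Rightarrow> nat pmf" +
  assumes indep_arrivals:
      "indep_vars (\<lambda>_. count_space UNIV)
         (case_sum (\<lambda>(z, k). a_c z k) (\<lambda>(z, k). a_s z k)) (UNIV :: (int \<times> nat + int \<times> nat) set)"
    and law_customers: "\<And>z k. distr M (count_space UNIV) (a_c z k) = measure_pmf (C z)"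
    and law_servers: "\<And>z k. distr M (count_space UNIV) (a_s z k) = measure_pmf (S z)"
begin

definition step :: "nat \<Rightarrow> int \<Rightarrow> 'a \<Rightarrow> int" where
  "step k z \<omega> = z + int (a_c z k \<omega>) - int (a_s z k \<omega>)"

primrec imbalance :: "nat \<Rightarrow> 'a \<Rightarrow> int" where
  "imbalance 0 \<omega> = 0"
| "imbalance (Suc k) \<omega> = step k (imbalance k \<omega>) \<omega>"

text \<open>
  The one-step transition matrix. Time \<open>0\<close> stands for every time, by \<open>prob_step\<close> below;
  \<open>imbalance_markov\<close> shows that it is the transition matrix of the chain \<open>imbalance\<close>.
\<close>

definition transition :: "int \<Rightarrow> int \<Rightarrow> real" where
  "transition z y = \<P>(\<omega> in M. step 0 z \<omega> = y)"

definition stationary :: "int pmf \<Rightarrow> bool" where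
  "stationary \<pi> \<longleftrightarrow> (\<forall>y. ((\<lambda>z. pmf \<pi> z * transition z y) has_sum pmf \<pi> y) UNIV)"

text \<open>
  \<open>Z\<close> may live on a probability space \<open>N\<close> other than \<open>M\<close>: only its law is prescribed.
\<close>

definition steady_state_imbalance :: "'b measure \<Rightarrow> ('b \<Rightarrow> int) \<Rightarrow> bool" where
  "steady_state_imbalance N Z \<longleftrightarrow>
     prob_space N \<and> Z \<in> measurable N (count_space UNIV) \<and>
     (\<exists>\<pi>. stationary \<pi> \<and> distr N (count_space UNIV) Z = measure_pmf \<pi>)"

lemma indep_pairs:
  "indep_vars (\<lambda>j. PiM {Inl (x j, j), Inr (x j, j)} (\<lambda>_. count_space UNIV))
     (\<lambda>j \<omega>. restrict (\<lambda>i. case_sum (\<lambda>(z, k). a_c z k) (\<lambda>(z, k). a_s z k) i \<omega>)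
        {Inl (x j, j), Inr (x j, j)}) UNIV"
  by (rule indep_vars_restrict[OF indep_arrivals]) (auto simp: disjoint_family_on_def)

lemma indep_steps: "indep_vars (\<lambda>_. count_space UNIV) (\<lambda>j. step j (x j)) UNIV"
proof -
  let ?f = "\<lambda>j g. x j + int (g (Inl (x j, j))) - int (g (Inr (x j, j)))"
  have "indep_vars (\<lambda>_. count_space UNIV) (\<lambda>j \<omega>. ?f j
      (restrict (\<lambda>i. case_sum (\<lambda>(z, k). a_c z k) (\<lambda>(z, k). a_s z k) i \<omega>)
        {Inl (x j, j), Inr (x j, j)})) UNIV"
    by (rule indep_vars_compose2[OF indep_pairs]) simp
  then show ?thesis
    by (simp add: step_def[abs_def])
qed

lemma prob_step: "\<P>(\<omega> in M. step k z \<omega> = y) = transition z y"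
proof -
  let ?A = "{p :: nat \<times> nat. z + int (fst p) - int (snd p) = y}"
  have "\<P>(\<omega> in M. step k z \<omega> = y) = measure (measure_pmf (C z) \<Otimes>\<^sub>M measure_pmf (S z)) ?A" for k
  proof -
    let ?X = "case_sum (\<lambda>(z, k). a_c z k) (\<lambda>(z, k). a_s z k)"
    have "indep_var (PiM {Inl (z, k)} (\<lambda>_. count_space UNIV)) (\<lambda>\<omega>. restrict (\<lambda>i. ?X i \<omega>) {Inl (z, k)})
       (PiM {Inr (z, k)} (\<lambda>_. count_space UNIV)) (\<lambda>\<omega>. restrict (\<lambda>i. ?X i \<omega>) {Inr (z, k)})"
      by (rule indep_var_restrict[OF indep_arrivals]) auto
    then have "indep_var (count_space UNIV) ((\<lambda>g. g (Inl (z, k))) \<circ> (\<lambda>\<omega>. restrict (\<lambda>i. ?X i \<omega>) {Inl (z, k)}))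
       (count_space UNIV) ((\<lambda>g. g (Inr (z, k))) \<circ> (\<lambda>\<omega>. restrict (\<lambda>i. ?X i \<omega>) {Inr (z, k)}))"
      by (rule indep_var_compose) simp_all
    then have ind: "indep_var (count_space UNIV) (a_c z k) (count_space UNIV) (a_s z k)"
      by (simp add: comp_def)
    then have rv: "a_c z k \<in> M \<rightarrow>\<^sub>M count_space UNIV" "a_s z k \<in> M \<rightarrow>\<^sub>M count_space UNIV"
      and eq: "distr M (count_space UNIV \<Otimes>\<^sub>M count_space UNIV) (\<lambda>\<omega>. (a_c z k \<omega>, a_s z k \<omega>)) =
        measure_pmf (C z) \<Otimes>\<^sub>M measure_pmf (S z)"
      by (simp_all add: indep_var_distribution_eq law_customers law_servers)
    have "count_space (UNIV :: nat set) \<Otimes>\<^sub>M count_space (UNIV :: nat set) = count_space UNIV"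
      by (subst pair_measure_countable) auto
    then have "?A \<in> sets (count_space UNIV \<Otimes>\<^sub>M count_space UNIV)"
      by (simp only: sets_count_space Pow_UNIV UNIV_I)
    then show ?thesis
      unfolding eq[symmetric] using rv
      by (subst measure_distr) (auto simp: step_def intro!: arg_cong[where f = "measure M"])
  qed
  then show ?thesis
    by (simp add: transition_def)
qed

lemma prob_steps:
  "\<P>(\<omega> in M. \<forall>i<n. step i (x i) \<omega> = y i) = (\<Prod>i<n. transition (x i) (y i))"
proof (cases "n = 0")
  case True
  then show ?thesis by (simp add: prob_space)
next
  case False
  have "prob (\<Inter>i\<in>{..<n}. step i (x i) -` {y i} \<inter> space M) =
      (\<Prod>i\<in>{..<n}. prob (step i (x i) -` {y i} \<inter> space M))"
    using False by (intro indep_varsD[OF indep_steps]) auto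
  also have "(\<Inter>i\<in>{..<n}. step i (x i) -` {y i} \<inter> space M) =
      {\<omega> \<in> space M. \<forall>i<n. step i (x i) \<omega> = y i}"
    using False by auto
  also have "(\<lambda>i. prob (step i (x i) -` {y i} \<inter> space M)) = (\<lambda>i. transition (x i) (y i))"
    by (intro ext, subst prob_step[symmetric], rule arg_cong[where f = prob]) auto
  finally show ?thesis .
qed

lemma imbalance_path:
  assumes "x 0 = 0"
  shows "(\<forall>i\<le>n. imbalance i \<omega> = x i) \<longleftrightarrow> (\<forall>i<n. step i (x i) \<omega> = x (Suc i))"
  using assms by (induction n) (auto simp: le_Suc_eq less_Suc_eq)

lemma imbalance_markov:
  "\<P>(\<omega> in M. (\<forall>i\<le>k. imbalance i \<omega> = x i) \<and> imbalance (Suc k) \<omega> = y) =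
   \<P>(\<omega> in M. \<forall>i\<le>k. imbalance i \<omega> = x i) * transition (x k) y"
proof (cases "x 0 = 0")
  case False
  then have "(\<forall>i\<le>k. imbalance i \<omega> = x i) \<longleftrightarrow> False" for \<omega>
    by (metis imbalance.simps(1) le0)
  then show ?thesis by (simp only: simp_thms) simp
next
  case True
  let ?y = "\<lambda>i. if i < k then x (Suc i) else y"
  have "(\<forall>i\<le>k. imbalance i \<omega> = x i) \<and> imbalance (Suc k) \<omega> = y \<longleftrightarrow>
      (\<forall>i<Suc k. step i (x i) \<omega> = ?y i)" for \<omega>
    using imbalance_path[of x k \<omega>, OF True] by (auto simp: less_Suc_eq)
  then have "\<P>(\<omega> in M. (\<forall>i\<le>k. imbalance i \<omega> = x i) \<and> imbalance (Suc k) \<omega> = y) =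
      (\<Prod>i<Suc k. transition (x i) (?y i))"
    by (simp only: prob_steps)
  also have "\<dots> = (\<Prod>i<k. transition (x i) (x (Suc i))) * transition (x k) y"
    by simp
  also have "(\<Prod>i<k. transition (x i) (x (Suc i))) = \<P>(\<omega> in M. \<forall>i\<le>k. imbalance i \<omega> = x i)"
    by (simp only: imbalance_path[of x, OF True] prob_steps)
  finally show ?thesis .
qed

end

text \<open>
  Convergence in distribution along an arbitrary filter, so that the index may be a real number
  tending to infinity; each variable may live on its own probability space.
\<close>

definition converges_in_distribution ::
    "('i \<Rightarrow> 'b measure) \<Rightarrow> ('i \<Rightarrow> 'b \<Rightarrow> real) \<Rightarrow> real measure \<Rightarrow> 'i filter \<Rightarrow> bool" where
  "converges_in_distribution N X \<mu> F \<longleftrightarrow>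
     (\<forall>x. isCont (cdf \<mu>) x \<longrightarrow>
        ((\<lambda>i. cdf (distr (N i) borel (X i)) x) \<longlongrightarrow> cdf \<mu> x) F)"

lemma converges_in_distribution_sequentially:
  "converges_in_distribution N X \<mu> sequentially \<longleftrightarrow> weak_conv_m (\<lambda>n. distr (N n) borel (X n)) \<mu>"
  by (simp add: converges_in_distribution_def weak_conv_m_def weak_conv_def)

definition laplace_distribution :: "real \<Rightarrow> real measure" where
  "laplace_distribution r = density lborel (\<lambda>x. ennreal (r / 2 * exp (- r * \<bar>x\<bar>)))"

definition hybrid_weight :: "real \<Rightarrow> real \<Rightarrow> real \<Rightarrow> real" where
  "hybrid_weight b c x =
     exp (- (LBINT y=0..x. b * indicator {y. y \<ge> c} y - b * indicator {y. y \<le> - c} y))"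

definition hybrid_distribution :: "real \<Rightarrow> real \<Rightarrow> real measure" where
  "hybrid_distribution b c =
     density lborel (\<lambda>x. ennreal (hybrid_weight b c x / (LBINT y. hybrid_weight b c y)))"

definition bernoulli_nat :: "real \<Rightarrow> nat pmf" where
  "bernoulli_nat p = map_pmf of_bool (bernoulli_pmf p)"

end

theory Submission
  imports Defs "HOL-Real_Asymp.Real_Asymp"
begin

text \<open>
  The imbalance moves by at most one unit per step, so it is a birth-death chain, and its stationary
  law can be written down. With \<open>p = \<lambda>\<^sup>\<star> = \<mu>\<^sup>\<star>\<close> and \<open>n = \<lfloor>\<tau>\<rfloor>\<close>, the chain goes up and down with the same
  probability \<open>a = p (1 - p)\<close> inside \<open>[-n, n]\<close>; above \<open>n\<close> it goes up with probability
  \<open>u = (p - \<epsilon>) (1 - p)\<close> and down with probability \<open>d = p (1 - p + \<epsilon>)\<close>, and below \<open>-n\<close> the roles are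
  exchanged. The stationary equations say that the net probability flow across every edge
  \<open>{z, z + 1}\<close> is the same; a summable law forces it to vanish
  (\<open>birth_death_detailed_balance\<close>). Hence the stationary law is symmetric, constant on \<open>[-n, n]\<close> and
  geometric with ratio \<open>\<rho> = u / d\<close> outside.

  Since \<open>d - u = \<epsilon>\<close>, the geometric tails sum to a simple closed form: relative to the mass at \<open>0\<close>, the
  ray \<open>{m + 1, m + 2, \<dots>}\<close> with \<open>m \<ge> 0\<close> has weight \<open>(n - m)\<^sup>+ + (a / \<epsilon>) \<rho>^((m - n)\<^sup>+)\<close>
  (\<open>stationary_tail\<close>, \<open>two_price_stationary\<close>). Multiply this by a scale \<open>s \<rightarrow> 0\<close> with
  \<open>s n \<rightarrow> c\<close>, \<open>s m \<rightarrow> x\<close> and \<open>a s / \<epsilon> \<rightarrow> A\<close>. If \<open>A > 0\<close>, then \<open>\<epsilon> \<rightarrow> 0\<close>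
  and \<open>ln \<rho> \<sim> - \<epsilon> / a\<close>; if \<open>A = 0\<close>, the geometric term vanishes. Either way the limit is
  \<open>(c - x)\<^sup>+ + A exp (- (x - c)\<^sup>+ / A)\<close>, which is, up to the factor \<open>2 (c + A)\<close>, the tail of a law that is
  flat on \<open>[-c, c]\<close> with exponential tails of rate \<open>1 / A\<close> (\<open>steady_state_cdf_tendsto\<close>).

  All four assertions are instances of this one limit. The scale \<open>s = \<epsilon>\<close> gives \<open>A = a\<close> and \<open>c = l\<close>:
  the Laplace law if \<open>l = 0\<close>, the hybrid law if \<open>0 < l < \<infinity>\<close>. The scale \<open>s = 1 / \<tau>\<close> gives \<open>c = 1\<close> and
  \<open>A = a / l\<close>: the hybrid law if \<open>0 < l < \<infinity>\<close>, and for \<open>l = \<infinity>\<close> the degenerate case \<open>A = 0\<close>, the uniform law.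
\<close>

section \<open>Transition probabilities\<close>

lemma (in matching_queue) measurable_arrivals:
  shows "a_c z k \<in> measurable M (count_space UNIV)"
    and "a_s z k \<in> measurable M (count_space UNIV)"
    and "(\<lambda>\<omega>. (a_c z k \<omega>, a_s z k \<omega>)) \<in> measurable M (count_space UNIV)"
proof -
  show rv: "a_c z k \<in> measurable M (count_space UNIV)"
    "a_s z k \<in> measurable M (count_space UNIV)"
    using indep_arrivals unfolding indep_vars_def
    by (metis (no_types, lifting) UNIV_I old.sum.simps(5) case_prod_conv,
        metis (no_types, lifting) UNIV_I old.sum.simps(6) case_prod_conv)
  have "count_space (UNIV :: nat set) \<Otimes>\<^sub>M count_space (UNIV :: nat set) = count_space UNIV"
    by (subst pair_measure_countable) auto
  with measurable_Pair[OF rv] show "(\<lambda>\<omega>. (a_c z k \<omega>, a_s z k \<omega>)) \<in> measurable M (count_space UNIV)"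
    by simp
qed

lemma (in matching_queue) prob_arrivals:
  "\<P>(\<omega> in M. a_c z k \<omega> = i \<and> a_s z k \<omega> = j) = pmf (C z) i * pmf (S z) j"
proof -
  let ?X = "case_sum (\<lambda>(z, k). a_c z k) (\<lambda>(z, k). a_s z k)"
  let ?A = "case_sum (\<lambda>_. {i}) (\<lambda>_. {j}) :: int \<times> nat + int \<times> nat \<Rightarrow> nat set"
  let ?K = "{Inl (z, k), Inr (z, k)} :: (int \<times> nat + int \<times> nat) set"
  have "prob (\<Inter>v\<in>?K. ?X v -` ?A v \<inter> space M) = (\<Prod>v\<in>?K. prob (?X v -` ?A v \<inter> space M))"
    by (rule indep_varsD[OF indep_arrivals]) auto
  also have "\<dots> = prob (a_c z k -` {i} \<inter> space M) * prob (a_s z k -` {j} \<inter> space M)"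
    by simp
  also have "prob (a_c z k -` {i} \<inter> space M) = pmf (C z) i"
    using measure_distr[OF measurable_arrivals(1), of "{i}"] by (simp add: law_customers measure_pmf_single)
  also have "prob (a_s z k -` {j} \<inter> space M) = pmf (S z) j"
    using measure_distr[OF measurable_arrivals(2), of "{j}"] by (simp add: law_servers measure_pmf_single)
  finally show ?thesis
    by (auto intro!: arg_cong[where f = prob] elim!: back_subst[of "\<lambda>x. x = _"])
qed

lemma (in matching_queue) distr_arrivals:
  "distr M (count_space UNIV) (\<lambda>\<omega>. (a_c z k \<omega>, a_s z k \<omega>)) = measure_pmf (pair_pmf (C z) (S z))"
proof (rule measure_eqI_countable[of _ UNIV])
  fix p :: "nat \<times> nat"
  have rv2: "(\<lambda>\<omega>. (a_c z k \<omega>, a_s z k \<omega>)) \<in> measurable M (count_space UNIV)"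
    by (rule measurable_arrivals)
  obtain i j where p: "p = (i, j)" by force
  have "emeasure (distr M (count_space UNIV) (\<lambda>\<omega>. (a_c z k \<omega>, a_s z k \<omega>))) {p}
      = ennreal (\<P>(\<omega> in M. a_c z k \<omega> = i \<and> a_s z k \<omega> = j))"
    using rv2 by (subst emeasure_distr)
      (auto simp: p emeasure_eq_measure intro!: arg_cong[where f = prob])
  then show "emeasure (distr M (count_space UNIV) (\<lambda>\<omega>. (a_c z k \<omega>, a_s z k \<omega>))) {p}
      = emeasure (measure_pmf (pair_pmf (C z) (S z))) {p}"
    by (simp add: prob_arrivals emeasure_pmf_single p pmf_pair)
qed auto

lemma (in matching_queue) transition_eq_pmf:
  "transition z y = pmf (map_pmf (\<lambda>(i, j). z + int i - int j) (pair_pmf (C z) (S z))) y"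
proof -
  have rv2: "(\<lambda>\<omega>. (a_c z 0 \<omega>, a_s z 0 \<omega>)) \<in> measurable M (count_space UNIV)"
    by (rule measurable_arrivals)
  show ?thesis
    using measure_distr[OF rv2, of "(\<lambda>(i, j). z + int i - int j) -` {y}"]
    by (auto simp: transition_def step_def pmf_map distr_arrivals vimage_def
        intro!: arg_cong[where f = prob])
qed

lemma pmf_bernoulli_difference:
  assumes "0 \<le> p" "p \<le> 1" "0 \<le> q" "q \<le> 1"
  shows "pmf (map_pmf (\<lambda>(i, j). z + int i - int j) (pair_pmf (bernoulli_nat p) (bernoulli_nat q))) y
    = (if y = z + 1 then p * (1 - q) else if y = z - 1 then q * (1 - p)
       else if y = z then 1 - p * (1 - q) - q * (1 - p) else 0)"
proof -
  have "pair_pmf (bernoulli_nat p) (bernoulli_nat q)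
      = map_pmf (map_prod of_bool of_bool) (pair_pmf (bernoulli_pmf p) (bernoulli_pmf q))"
    by (simp add: bernoulli_nat_def map_pair map_prod_def)
  then have "pmf (map_pmf (\<lambda>(i, j). z + int i - int j) (pair_pmf (bernoulli_nat p) (bernoulli_nat q))) y
     = measure (measure_pmf (pair_pmf (bernoulli_pmf p) (bernoulli_pmf q)))
        {(b, c). z + of_bool b - of_bool c = y}"
    by (auto simp: pmf_map map_pmf_comp vimage_def intro!: arg_cong[where f = "measure _"])
  also have "{(b, c). z + of_bool b - of_bool c = y} =
     {x \<in> {(True, True), (True, False), (False, True), (False, False)}.
        z + of_bool (fst x) - of_bool (snd x) = y}"
    by auto
  also have "measure (measure_pmf (pair_pmf (bernoulli_pmf p) (bernoulli_pmf q))) \<dots> =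
     (\<Sum>x \<in> {(True, True), (True, False), (False, True), (False, False)}.
        if z + of_bool (fst x) - of_bool (snd x) = y
        then pmf (pair_pmf (bernoulli_pmf p) (bernoulli_pmf q)) x else 0)"
    by (subst measure_measure_pmf_finite, simp, rule sum.inter_filter, simp)
  finally show ?thesis using assms
    by (auto simp: pmf_pair algebra_simps)
qed

section \<open>Stationary laws of birth-death chains on the integers\<close>

lemma sums_pmf_ray:
  fixes q :: "int pmf"
  shows "(\<lambda>j. pmf q (z + 1 + int j)) sums measure (measure_pmf q) {z <..}"
proof -
  have "(\<lambda>j. measure (measure_pmf q) {z + 1 + int j}) sums
      measure (measure_pmf q) (\<Union>j. {z + 1 + int j})"
    by (rule measure_pmf.finite_measure_UNION) (auto simp: disjoint_family_on_def)
  also have "(\<Union>j. {z + 1 + int j}) = {z <..}"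
  proof -
    have "y \<in> (\<Union>j. {z + 1 + int j})" if "z < y" for y
      using that by (intro UN_I[of "nat (y - z - 1)"]) auto
    then show ?thesis by auto
  qed
  finally show ?thesis
    by (simp add: measure_pmf_single)
qed

lemma measure_pmf_symmetric_tails:
  fixes q :: "int pmf"
  assumes "\<And>z. pmf q (- z) = pmf q z"
  shows "measure (measure_pmf q) {..< - z} = measure (measure_pmf q) {z <..}"
proof -
  have "map_pmf uminus q = q"
  proof (rule pmf_eqI)
    fix y
    show "pmf (map_pmf uminus q) y = pmf q y"
      using pmf_map_inj'[of uminus q "- y"] assms by (simp add: inj_def)
  qed
  then have "measure (measure_pmf q) {z <..} = measure (measure_pmf (map_pmf uminus q)) {z <..}"
    by simp
  also have "\<dots> = measure (measure_pmf q) {..< - z}"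
    by (subst measure_map_pmf) (auto intro!: arg_cong[where f = "measure _"])
  finally show ?thesis by simp
qed

text \<open>
  The balance equation at \<open>y\<close> says that the net flow \<open>F\<close> across the edge \<open>{y, y + 1}\<close> equals the one
  across \<open>{y - 1, y}\<close>. So \<open>F\<close> is constant; and it is bounded by the sum of the masses of two
  neighbouring states, which tend to \<open>0\<close> at infinity.
\<close>

lemma birth_death_detailed_balance:
  fixes q :: "int pmf" and u d :: "int \<Rightarrow> real"
  assumes P: "\<And>z y. P z y = (if y = z + 1 then u z else if y = z - 1 then d z
       else if y = z then 1 - u z - d z else 0)"
    and bal: "\<And>y. ((\<lambda>z. pmf q z * P z y) has_sum pmf q y) UNIV"
    and bound: "\<And>z. \<bar>u z\<bar> \<le> 1" "\<And>z. \<bar>d z\<bar> \<le> 1"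
  shows "pmf q z * u z = pmf q (z + 1) * d (z + 1)"
proof -
  define F where "F y = pmf q y * u y - pmf q (y + 1) * d (y + 1)" for y
  have F: "F y = F (y - 1)" for y
  proof -
    have "((\<lambda>z. pmf q z * P z y) has_sum pmf q y) {y - 1, y, y + 1}"
      using bal[of y] by (rule has_sum_cong_neutral[THEN iffD1, rotated -1]) (auto simp: P)
    then have "pmf q y = (\<Sum>z\<in>{y - 1, y, y + 1}. pmf q z * P z y)"
      by (simp add: has_sum_finite_iff)
    then show ?thesis
      by (simp add: P F_def algebra_simps)
  qed
  have const: "F (z + int k) = F z" for k
  proof (induction k)
    case (Suc k)
    show ?case using F[of "z + int (Suc k)"] Suc by (simp add: algebra_simps)
  qed simp
  have summable: "summable (\<lambda>k. pmf q (y + int k))" for y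
    using sums_pmf_ray[of q "y - 1"] by (simp add: sums_summable)
  have "(\<lambda>k. F (z + int k)) \<longlonglongrightarrow> 0"
  proof (rule Lim_null_comparison)
    show "\<forall>\<^sub>F k in sequentially. norm (F (z + int k)) \<le> pmf q (z + int k) + pmf q (z + 1 + int k)"
    proof (rule always_eventually, rule allI)
      fix k
      have "\<bar>pmf q y * u y\<bar> \<le> pmf q y" "\<bar>pmf q y * d y\<bar> \<le> pmf q y" for y
        using bound[of y] by (simp_all add: abs_mult mult_left_le)
      note this(1)[of "z + int k"] this(2)[of "z + int k + 1"]
      then show "norm (F (z + int k)) \<le> pmf q (z + int k) + pmf q (z + 1 + int k)"
        unfolding F_def by (simp add: algebra_simps)
    qed
    show "(\<lambda>k. pmf q (z + int k) + pmf q (z + 1 + int k)) \<longlonglongrightarrow> 0"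
      by (intro tendsto_add_zero summable_LIMSEQ_zero summable)
  qed
  then have "F z = 0" by (simp add: const LIMSEQ_const_iff)
  then show ?thesis by (simp add: F_def)
qed

section \<open>The stationary law under the two-price policy\<close>

text \<open>
  The weight, relative to the mass at \<open>0\<close>, that the stationary law gives to all states above \<open>m\<close>.
  Truncated subtraction on the naturals makes one expression serve both sides of the threshold \<open>n\<close>:
  for \<open>m < n\<close> the power is \<open>1\<close>, for \<open>m \<ge> n\<close> the linear term is \<open>0\<close>.
\<close>

definition stationary_tail :: "real \<Rightarrow> real \<Rightarrow> nat \<Rightarrow> nat \<Rightarrow> real" where
  "stationary_tail p e n m =
     real (n - m) + p * (1 - p) / e * ((p - e) * (1 - p) / (p * (1 - p + e))) ^ (m - n)"

lemma two_price_ratio: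
  fixes p e :: real
  assumes "0 < e" "e < p" "p < 1"
  shows "0 < (p - e) * (1 - p) / (p * (1 - p + e))" "(p - e) * (1 - p) / (p * (1 - p + e)) < 1"
    and "1 - (p - e) * (1 - p) / (p * (1 - p + e)) = e / (p * (1 - p + e))"
proof -
  have d: "p * (1 - p + e) > 0" using assms by auto
  then show "1 - (p - e) * (1 - p) / (p * (1 - p + e)) = e / (p * (1 - p + e))"
  proof -
    have "(p - e) * (1 - p) = p * (1 - p + e) - e" by (simp add: algebra_simps)
    moreover have "1 - p + e \<noteq> 0" "p \<noteq> 0" using assms by auto
    ultimately show ?thesis by (simp add: diff_divide_distrib)
  qed
  moreover have "0 < e / (p * (1 - p + e))" using d assms by (intro divide_pos_pos)
  ultimately show "(p - e) * (1 - p) / (p * (1 - p + e)) < 1" by linarith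
  show "0 < (p - e) * (1 - p) / (p * (1 - p + e))" using d assms by (intro divide_pos_pos) auto
qed

text \<open>
  The closed form of the tail is verified through its differences, which are the weights of the
  single states. Beyond the threshold, \<open>1 - \<rho> = \<epsilon> / d\<close> cancels the factor \<open>1 / \<epsilon>\<close>.
\<close>

lemma stationary_tail_diff:
  fixes p e :: real
  assumes "0 < e" "e < p" "p < 1"
  shows "stationary_tail p e n m - stationary_tail p e n (Suc m) =
    (if m < n then 1 else p * (1 - p) / (p * (1 - p + e)) *
       ((p - e) * (1 - p) / (p * (1 - p + e))) ^ (m - n))"
proof (cases "m < n")
  case True
  then show ?thesis by (simp add: stationary_tail_def of_nat_diff)
next
  case False
  define \<rho> where "\<rho> = (p - e) * (1 - p) / (p * (1 - p + e))"
  define K where "K = p * (1 - p) / e"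
  have G: "stationary_tail p e n k = real (n - k) + K * \<rho> ^ (k - n)" for k
    by (simp only: stationary_tail_def \<rho>_def K_def)
  have "stationary_tail p e n m - stationary_tail p e n (Suc m) =
      K * (\<rho> ^ (m - n) * (1 - \<rho>))"
    using False by (simp add: G Suc_diff_le algebra_simps)
  also have "1 - \<rho> = e / (p * (1 - p + e))"
    unfolding \<rho>_def by (rule two_price_ratio(3)[OF assms])
  also have "K * (\<rho> ^ (m - n) * (e / (p * (1 - p + e)))) =
      p * (1 - p) / (p * (1 - p + e)) * \<rho> ^ (m - n)"
    using assms(1) by (simp add: K_def)
  finally show ?thesis using False by (simp only: \<rho>_def if_False)
qed

lemma stationary_tail_tendsto_0:
  fixes p e :: real
  assumes "0 < e" "e < p" "p < 1"
  shows "stationary_tail p e n \<longlonglongrightarrow> 0"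
proof (rule LIMSEQ_offset)
  have "\<bar>(p - e) * (1 - p) / (p * (1 - p + e))\<bar> < 1"
    using two_price_ratio(1,2)[OF assms] by (simp only: abs_of_pos)
  then have "(\<lambda>j. p * (1 - p) / e * ((p - e) * (1 - p) / (p * (1 - p + e))) ^ j) \<longlonglongrightarrow> p * (1 - p) / e * 0"
    by (intro tendsto_mult tendsto_const LIMSEQ_power_zero) (simp only: real_norm_def)
  then show "(\<lambda>j. stationary_tail p e n (j + n)) \<longlonglongrightarrow> 0"
    by (simp add: stationary_tail_def)
qed

text \<open>
  Detailed balance read outwards from \<open>0\<close>. By symmetry of the policy it is the same recurrence on the
  positive and on the negative half-line, so it is solved once for a function on the naturals.
\<close>

lemma two_price_recurrence:
  fixes p e :: real and f :: "nat \<Rightarrow> real"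
  assumes pe: "0 < e" "e < p" "p < 1"
    and rec: "\<And>k. f k * (if k \<le> n then p * (1 - p) else (p - e) * (1 - p)) =
       f (Suc k) * (if k < n then p * (1 - p) else p * (1 - p + e))"
  shows "f (Suc k) = f 0 * (stationary_tail p e n k - stationary_tail p e n (Suc k))"
proof -
  define d where "d = p * (1 - p + e)"
  define a where "a = p * (1 - p)"
  have pos: "a > 0" "d > 0" using pe by (auto simp: a_def d_def)
  have low: "f k = f 0" if "k \<le> n" for k
    using that
  proof (induction k)
    case (Suc k)
    have "f k * a = f (Suc k) * a" using rec[of k] Suc.prems by (simp add: a_def)
    then show ?case using Suc pos(1) by simp
  qed simp
  have high: "f (Suc (n + j)) = f 0 * (a / d * ((p - e) * (1 - p) / d) ^ j)" for j
  proof (induction j)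
    case 0
    have "f n * a = f (Suc n) * d" using rec[of n] by (simp add: a_def d_def)
    then show ?case using low[of n] pos by (simp add: field_simps)
  next
    case (Suc j)
    have "f (Suc (n + Suc j)) = f (Suc (n + j)) * ((p - e) * (1 - p) / d)"
    proof -
      have "f (Suc (n + j)) * ((p - e) * (1 - p)) = f (Suc (n + Suc j)) * d"
        using rec[of "Suc (n + j)"] by (simp add: d_def)
      then show ?thesis using pos by (simp add: nonzero_eq_divide_eq)
    qed
    then show ?case by (simp add: Suc)
  qed
  show ?thesis
  proof (cases "k < n")
    case True
    then show ?thesis using low[of "Suc k"] by (simp add: stationary_tail_diff[OF pe])
  next
    case False
    then show ?thesis using high[of "k - n"]
      by (simp add: stationary_tail_diff[OF pe] a_def d_def)
  qed
qed

text \<open>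
  Both half-lines solve the same recurrence with the same value at \<open>0\<close>, whence the symmetry. The tail
  sums telescope, and the total mass determines the mass at \<open>0\<close>.
\<close>

lemma two_price_stationary_tail:
  fixes q :: "int pmf" and p e :: real
  assumes pe: "0 < e" "e < p" "p < 1"
    and bal: "\<And>z. pmf q z * (if z < - int n then p * (1 - p + e) else if z \<le> int n then p * (1 - p)
          else (p - e) * (1 - p)) =
        pmf q (z + 1) * (if z + 1 < - int n then (p - e) * (1 - p) else if z + 1 \<le> int n then p * (1 - p)
          else p * (1 - p + e))"
  shows "measure (measure_pmf q) {int m <..} =
        stationary_tail p e n m / (1 + 2 * stationary_tail p e n 0)" (is ?tail)
    and "measure (measure_pmf q) {..< - int m} = measure (measure_pmf q) {int m <..}" (is ?sym)
proof -
  let ?G = "stationary_tail p e n"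
  have right: "pmf q (int (Suc k)) = pmf q 0 * (?G k - ?G (Suc k))" for k
    using two_price_recurrence[OF pe, of "\<lambda>k. pmf q (int k)" n k] bal[of "int _"]
    by (simp add: add.commute)
  have left: "pmf q (- int (Suc k)) = pmf q 0 * (?G k - ?G (Suc k))" for k
  proof -
    have "pmf q (- int k) * (if k \<le> n then p * (1 - p) else (p - e) * (1 - p)) =
       pmf q (- int (Suc k)) * (if k < n then p * (1 - p) else p * (1 - p + e))" for k
      using bal[of "- int (Suc k)"] pe by (cases k n rule: linorder_cases) auto
    from two_price_recurrence[OF pe, of "\<lambda>k. pmf q (- int k)" n k, OF this] show ?thesis
      by simp
  qed
  have sym: "pmf q (- z) = pmf q z" for z
  proof -
    have "pmf q (- int k) = pmf q (int k)" for k
      using left right by (cases k) auto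
    from this[of "nat \<bar>z\<bar>"] show ?thesis by (cases "z \<ge> 0") auto
  qed
  show ?sym by (rule measure_pmf_symmetric_tails[OF sym])
  have tail: "measure (measure_pmf q) {int m <..} = pmf q 0 * ?G m" for m
  proof -
    have "(\<lambda>j. ?G (m + j) - ?G (m + Suc j)) sums (?G (m + 0) - 0)"
      using stationary_tail_tendsto_0[OF pe, of n]
      by (intro telescope_sums') (simp add: LIMSEQ_ignore_initial_segment add.commute[of m])
    then have "(\<lambda>j. pmf q 0 * (?G (m + j) - ?G (m + Suc j))) sums (pmf q 0 * ?G m)"
      by (intro sums_mult) simp
    also have "(\<lambda>j. pmf q 0 * (?G (m + j) - ?G (m + Suc j))) = (\<lambda>j. pmf q (int m + 1 + int j))"
      using right[of "m + _"] by (simp add: add_ac)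
    finally show ?thesis
      using sums_pmf_ray[of q "int m"] sums_unique2 by blast
  qed
  have "1 = measure (measure_pmf q) ({..< 0} \<union> ({0} \<union> {0 <..}))"
  proof -
    have "{..< 0} \<union> ({0} \<union> {0 <..}) = (UNIV :: int set)" by auto
    then show ?thesis by (simp only:) simp
  qed
  also have "\<dots> = measure (measure_pmf q) {..< 0} + measure (measure_pmf q) ({0} \<union> {0 <..})"
    by (rule measure_pmf.finite_measure_Union) auto
  also have "measure (measure_pmf q) ({0} \<union> {0 <..}) = pmf q 0 + measure (measure_pmf q) {0 <..}"
    by (subst measure_pmf.finite_measure_Union) (auto simp: measure_pmf_single)
  also have "measure (measure_pmf q) {..< 0} + (pmf q 0 + measure (measure_pmf q) {0 <..}) =
      pmf q 0 * (1 + 2 * ?G 0)"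
    using measure_pmf_symmetric_tails[OF sym, of 0] tail[of 0] by (simp add: algebra_simps)
  finally have "pmf q 0 = 1 / (1 + 2 * ?G 0)"
    by (metis mult_zero_right nonzero_eq_divide_eq zero_neq_one)
  then show ?tail using tail by simp
qed

text \<open>
  An integer exceeds the threshold \<open>t\<close> exactly when it exceeds \<open>\<lfloor>t\<rfloor>\<close>, so only the integer part of
  the threshold matters.
\<close>

lemma (in matching_queue) two_price_stationary:
  assumes stat: "stationary q"
    and C: "C = (\<lambda>z. bernoulli_nat (p - e * indicator {z. real_of_int z > t} z))"
    and S: "S = (\<lambda>z. bernoulli_nat (p - e * indicator {z. real_of_int z < - t} z))"
    and pe: "0 < e" "e < p" "p < 1" and t: "t > 0"
  shows "measure (measure_pmf q) {int m <..} =
        stationary_tail p e (nat \<lfloor>t\<rfloor>) m / (1 + 2 * stationary_tail p e (nat \<lfloor>t\<rfloor>) 0)"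
    and "measure (measure_pmf q) {..< - int m} = measure (measure_pmf q) {int m <..}"
proof -
  define n where "n = nat \<lfloor>t\<rfloor>"
  have n: "real_of_int z > t \<longleftrightarrow> int n < z" "real_of_int z < - t \<longleftrightarrow> z < - int n" for z
    using t unfolding n_def by linarith+
  define lam where "lam z = (if int n < z then p - e else p)" for z
  define mu where "mu z = (if z < - int n then p - e else p)" for z
  have CS: "C z = bernoulli_nat (lam z)" "S z = bernoulli_nat (mu z)" for z
    by (simp_all add: C S lam_def mu_def n indicator_def)
  have range: "0 \<le> lam z" "lam z \<le> 1" "0 \<le> mu z" "mu z \<le> 1" for z
    using pe by (auto simp: lam_def mu_def)
  have prod_range: "\<bar>x * (1 - y)\<bar> \<le> 1" if "0 \<le> x" "x \<le> 1" "0 \<le> y" "y \<le> 1" for x y :: real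
    using that by (simp add: abs_mult mult_le_one)
  have "pmf q z * (lam z * (1 - mu z)) = pmf q (z + 1) * (mu (z + 1) * (1 - lam (z + 1)))" for z
  proof (rule birth_death_detailed_balance)
    show "transition z y = (if y = z + 1 then lam z * (1 - mu z) else if y = z - 1 then mu z * (1 - lam z)
       else if y = z then 1 - lam z * (1 - mu z) - mu z * (1 - lam z) else 0)" for z y
      unfolding transition_eq_pmf CS by (rule pmf_bernoulli_difference) (rule range)+
    show "((\<lambda>z. pmf q z * transition z y) has_sum pmf q y) UNIV" for y
      using stat by (simp add: stationary_def)
  qed (intro prod_range range)+
  moreover have "lam z * (1 - mu z) = (if z < - int n then p * (1 - p + e)
      else if z \<le> int n then p * (1 - p) else (p - e) * (1 - p))" for z
    by (simp add: lam_def mu_def)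
  moreover have "mu z * (1 - lam z) = (if z < - int n then (p - e) * (1 - p)
      else if z \<le> int n then p * (1 - p) else p * (1 - p + e))" for z
    by (simp add: lam_def mu_def)
  ultimately have bal: "pmf q z * (if z < - int n then p * (1 - p + e) else if z \<le> int n then p * (1 - p)
          else (p - e) * (1 - p)) =
        pmf q (z + 1) * (if z + 1 < - int n then (p - e) * (1 - p) else if z + 1 \<le> int n then p * (1 - p)
          else p * (1 - p + e))" for z
    by simp
  show "measure (measure_pmf q) {int m <..} =
        stationary_tail p e (nat \<lfloor>t\<rfloor>) m / (1 + 2 * stationary_tail p e (nat \<lfloor>t\<rfloor>) 0)"
    and "measure (measure_pmf q) {..< - int m} = measure (measure_pmf q) {int m <..}"
    unfolding n_def[symmetric] using two_price_stationary_tail[OF pe bal] by blast+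
qed

section \<open>Laws with a plateau and exponential tails\<close>

text \<open>
  The mass above \<open>x \<ge> 0\<close> of the law whose density is constant on \<open>[-c, c]\<close> and decays at rate
  \<open>1 / A\<close> outside. For \<open>A = 0\<close> the exponential is multiplied by \<open>0\<close> and there is no mass outside the
  plateau, so the uniform law on \<open>[-c, c]\<close> is included; \<open>c = 0\<close> gives the Laplace law.
\<close>

definition plateau_tail :: "real \<Rightarrow> real \<Rightarrow> real \<Rightarrow> real" where
  "plateau_tail c A x = (max 0 (c - x) + A * exp (- (max 0 (x - c) / A))) / (2 * (c + A))"

definition plateau_cdf :: "real \<Rightarrow> real \<Rightarrow> real \<Rightarrow> real" where
  "plateau_cdf c A x = (if x < 0 then plateau_tail c A (- x) else 1 - plateau_tail c A x)"

lemma nn_integral_plateau_tail: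
  fixes A c x :: real
  assumes A: "A > 0" and x: "0 \<le> x" and c: "0 \<le> c"
  shows "(\<integral>\<^sup>+y. ennreal (exp (- (max 0 (\<bar>y\<bar> - c) / A))) * indicator {x ..} y \<partial>lborel)
    = ennreal (max 0 (c - x) + A * exp (- (max 0 (x - c) / A)))"
proof -
  let ?f = "\<lambda>y. ennreal (exp (- (max 0 (\<bar>y\<bar> - c) / A)))"
  \<comment> \<open>Up to \<open>max x c\<close> the integrand is \<open>1\<close>; if \<open>x \<ge> c\<close>, this stretch is the single point \<open>x\<close>.\<close>
  let ?m = "max x c"
  have "AE y in lborel. y \<noteq> ?m" by (rule AE_lborel_singleton)
  then have "(\<integral>\<^sup>+y. ?f y * indicator {x ..} y \<partial>lborel) =
     (\<integral>\<^sup>+y. indicator {x..?m} y + ennreal (exp (- ((y - c) / A))) * indicator {?m ..} y \<partial>lborel)"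
    by (intro nn_integral_cong_AE, elim eventually_mono) (use x c in \<open>auto simp: indicator_def max_def\<close>)
  also have "\<dots> = (\<integral>\<^sup>+y. indicator {x..?m} y \<partial>lborel) +
      (\<integral>\<^sup>+y. ennreal (exp (- ((y - c) / A))) * indicator {?m ..} y \<partial>lborel)"
    by (rule nn_integral_add) auto
  also have "(\<integral>\<^sup>+y. ennreal (exp (- ((y - c) / A))) * indicator {?m ..} y \<partial>lborel) =
      ennreal (0 - (- A * exp (- ((?m - c) / A))))"
  proof (rule nn_integral_FTC_atLeast)
    show "((\<lambda>y. - A * exp (- ((y - c) / A))) \<longlongrightarrow> 0) at_top"
      using A by real_asymp
    show "((\<lambda>y. - A * exp (- ((y - c) / A))) has_real_derivative exp (- ((y - c) / A))) (at y)" for y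
      using A by (auto intro!: derivative_eq_intros)
  qed auto
  also have "(\<integral>\<^sup>+y. indicator {x..?m} y \<partial>lborel) = ennreal (max 0 (c - x))"
    by (auto simp: max_def)
  finally show ?thesis
    using A by (auto simp: max_def simp flip: ennreal_plus)
qed

text \<open>
  Right tails are given by \<open>nn_integral_plateau_tail\<close>. The density is even, so \<open>{..x}\<close> with \<open>x < 0\<close> has the mass of a
  right tail; for \<open>x \<ge> 0\<close> one passes to the complement.
\<close>

lemma cdf_plateau_density:
  fixes A c :: real
  assumes A: "A > 0" and c: "0 \<le> c"
  shows "cdf (density lborel (\<lambda>y. ennreal (exp (- (max 0 (\<bar>y\<bar> - c) / A)) / (2 * (c + A))))) x =
    plateau_cdf c A x"
proof -
  define K where "K = 2 * (c + A)"
  have K: "K > 0" using A c by (simp add: K_def)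
  let ?h = "\<lambda>y. ennreal (exp (- (max 0 (\<bar>y\<bar> - c) / A)) / K)"
  define D where "D = density lborel ?h"
  have D: "sets D = sets borel" "space D = UNIV" by (auto simp: D_def)
  have right: "emeasure D {y ..} = ennreal (plateau_tail c A y)" if "0 \<le> y" for y
  proof -
    have "emeasure D {y ..} = (\<integral>\<^sup>+z. ?h z * indicator {y ..} z \<partial>lborel)"
      unfolding D_def by (subst emeasure_density) auto
    also have "\<dots> = (\<integral>\<^sup>+z. ennreal (1 / K) * (ennreal (exp (- (max 0 (\<bar>z\<bar> - c) / A))) * indicator {y ..} z) \<partial>lborel)"
      using K by (intro nn_integral_cong) (auto simp: indicator_def simp flip: ennreal_mult)
    also have "\<dots> = ennreal (1 / K) * ennreal (max 0 (c - y) + A * exp (- (max 0 (y - c) / A)))"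
      by (subst nn_integral_cmult) (auto simp: nn_integral_plateau_tail[OF A that c])
    also have "\<dots> = ennreal (plateau_tail c A y)"
      using K A by (subst ennreal_mult[symmetric]) (auto simp: plateau_tail_def K_def)
    finally show ?thesis .
  qed
  have left: "emeasure D {.. - y} = emeasure D {y ..}" for y
  proof -
    have "emeasure D {.. - y} = (\<integral>\<^sup>+z. ?h z * indicator {.. - y} z \<partial>lborel)"
      unfolding D_def by (subst emeasure_density) auto
    also have "\<dots> = (\<integral>\<^sup>+z. ?h (- z) * indicator {.. - y} (- z) \<partial>lborel)"
      by (subst nn_integral_real_affine[where c = "-1" and t = 0]) auto
    also have "\<dots> = (\<integral>\<^sup>+z. ?h z * indicator {y ..} z \<partial>lborel)"
      by (intro nn_integral_cong) (auto simp: indicator_def)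
    also have "\<dots> = emeasure D {y ..}"
      unfolding D_def by (subst emeasure_density) auto
    finally show ?thesis .
  qed
  have nonneg: "0 \<le> plateau_tail c A y" for y
    using A c by (auto simp: plateau_tail_def intro!: divide_nonneg_nonneg add_nonneg_nonneg)
  have null: "emeasure D {y} = 0" for y
    unfolding D_def by (subst emeasure_density) (auto simp: nn_integral_0_iff_AE AE_lborel_singleton intro!: AE_mp[OF AE_lborel_singleton[of y]])
  have half: "plateau_tail c A 0 = 1 / 2"
    using A c by (simp add: plateau_tail_def max_def)
  show ?thesis
  proof (cases "x < 0")
    case True
    then have "emeasure D {.. x} = ennreal (plateau_tail c A (- x))"
      using left[of "- x"] right[of "- x"] by simp
    then show ?thesis using True nonneg
      by (simp add: cdf_def plateau_cdf_def measure_def D_def K_def)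
  next
    case False
    have open_tail: "emeasure D {x <..} = ennreal (plateau_tail c A x)"
    proof -
      have "emeasure D {x ..} = emeasure D {x} + emeasure D {x <..}"
        by (subst plus_emeasure) (auto simp: D intro!: arg_cong[where f = "emeasure D"])
      then show ?thesis using right[of x] False null by simp
    qed
    have "emeasure D UNIV = emeasure D {.. - 0} + emeasure D {0 <..}"
      by (subst plus_emeasure) (auto simp: D intro!: arg_cong[where f = "emeasure D"])
    also have "emeasure D {0 <..} = emeasure D {0 ..}"
    proof -
      have "{0} \<union> {0 <..} = {0 :: real ..}" by auto
      then show ?thesis
        using plus_emeasure[of "{0}" D "{0 <..}"] null[of 0] D by simp
    qed
    finally have total: "emeasure D UNIV = 1"
      using left[of 0] right[of 0] ennreal_plus[of "1 / 2" "1 / 2"] by (simp add: half)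
    have "prob_space D" using total D by (auto intro: prob_spaceI)
    then have "measure D (space D - {x <..}) = 1 - measure D {x <..}"
      by (intro prob_space.prob_compl) (auto simp: D)
    moreover have "space D - {x <..} = {.. x}" using D by auto
    moreover have "measure D {x <..} = plateau_tail c A x"
      using open_tail nonneg by (simp add: measure_def)
    ultimately show ?thesis using False
      by (simp add: cdf_def plateau_cdf_def D_def K_def)
  qed
qed

lemma hybrid_weight_eq:
  assumes "0 \<le> b" "0 < c"
  shows "hybrid_weight b c x = exp (- (b * max 0 (\<bar>x\<bar> - c)))"
proof -
  let ?g = "\<lambda>y. b * indicator {y. y \<ge> c} y - b * indicator {y. y \<le> - c} y :: real"
  show ?thesis
  proof (cases "0 \<le> x")
    case True
    have "(LBINT y=0..x. ?g y) = (LBINT y:{0..x}. b * indicator {c..} y)"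
      unfolding zero_ereal_def interval_integral_Icc[OF True] using assms
      by (intro set_lebesgue_integral_cong) (auto simp: indicator_def)
    also have "\<dots> = (LBINT y. b * indicator {c..x} y)"
      unfolding set_lebesgue_integral_def using assms
      by (intro Bochner_Integration.integral_cong) (auto simp: indicator_def)
    also have "\<dots> = b * max 0 (\<bar>x\<bar> - c)"
      using True by (auto simp: max_def)
    finally show ?thesis by (simp add: hybrid_weight_def)
  next
    case False
    then have x: "x \<le> 0" by simp
    have "(LBINT y=0..x. ?g y) = - (LBINT y:{x..0}. ?g y)"
      unfolding zero_ereal_def
      by (subst interval_integral_endpoints_reverse) (simp add: interval_integral_Icc[OF x])
    also have "(LBINT y:{x..0}. ?g y) = (LBINT y. - b * indicator {x..- c} y)"
      unfolding set_lebesgue_integral_def using assms x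
      by (intro Bochner_Integration.integral_cong) (auto simp: indicator_def)
    also have "\<dots> = - (b * max 0 (\<bar>x\<bar> - c))"
      using False by (auto simp: max_def)
    finally show ?thesis by (simp add: hybrid_weight_def)
  qed
qed

text \<open>
  What remains after \<open>hybrid_weight_eq\<close> is the normalizing constant: twice the tail integral at \<open>0\<close>,
  since the weight is even.
\<close>

lemma cdf_hybrid_distribution:
  assumes "0 < b" "0 < c"
  shows "cdf (hybrid_distribution b c) = plateau_cdf c (1 / b)"
proof -
  have w: "hybrid_weight b c = (\<lambda>x. exp (- (max 0 (\<bar>x\<bar> - c) / (1 / b))))"
    using assms by (simp add: fun_eq_iff hybrid_weight_eq mult.commute)
  have meas [measurable]: "hybrid_weight b c \<in> borel_measurable borel"
    unfolding w by measurable
  have even: "hybrid_weight b c (- y) = hybrid_weight b c y" for y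
    by (simp add: w)
  have nonneg: "0 \<le> hybrid_weight b c y" for y
    by (simp add: w)
  let ?f = "\<lambda>y. ennreal (hybrid_weight b c y)"
  have tail: "(\<integral>\<^sup>+y. ?f y * indicator {0 ..} y \<partial>lborel) = ennreal (c + 1 / b)"
    using nn_integral_plateau_tail[of "1 / b" 0 c] assms unfolding w by simp
  have "(\<integral>\<^sup>+y. ?f y \<partial>lborel) = (\<integral>\<^sup>+y. ?f y * indicator {0 ..} y + ?f y * indicator {..0} y \<partial>lborel)"
    by (rule nn_integral_cong_AE, rule AE_mp[OF AE_lborel_singleton[of 0]], rule AE_I2)
      (simp add: indicator_def)
  also have "\<dots> = ennreal (c + 1 / b) + (\<integral>\<^sup>+y. ?f y * indicator {..0} y \<partial>lborel)"
    unfolding tail[symmetric] by (rule nn_integral_add) measurable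
  also have "(\<integral>\<^sup>+y. ?f y * indicator {..0} y \<partial>lborel) = (\<integral>\<^sup>+y. ?f (- y) * indicator {..0} (- y) \<partial>lborel)"
    by (subst nn_integral_real_affine[where c = "-1" and t = 0]) simp_all
  also have "\<dots> = (\<integral>\<^sup>+y. ?f y * indicator {0 ..} y \<partial>lborel)"
    by (simp add: even indicator_def)
  finally have "(\<integral>\<^sup>+y. ?f y \<partial>lborel) = ennreal (2 * (c + 1 / b))"
    unfolding tail using assms by (simp flip: ennreal_plus)
  then have "(LBINT y. hybrid_weight b c y) = 2 * (c + 1 / b)"
    using assms nonneg by (subst integral_eq_nn_integral) (simp_all flip: ennreal_plus)
  then show ?thesis
    unfolding hybrid_distribution_def using cdf_plateau_density[of "1 / b" c] assms
    by (simp only: w) (simp add: fun_eq_iff)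
qed

lemma cdf_laplace_distribution:
  assumes "0 < r"
  shows "cdf (laplace_distribution r) = plateau_cdf 0 (1 / r)"
proof
  fix x
  have "laplace_distribution r =
     density lborel (\<lambda>y. ennreal (exp (- (max 0 (\<bar>y\<bar> - 0) / (1 / r))) / (2 * (0 + 1 / r))))"
    unfolding laplace_distribution_def by (simp add: mult.commute)
  then show "cdf (laplace_distribution r) x = plateau_cdf 0 (1 / r) x"
    using cdf_plateau_density[of "1 / r" 0 x] assms by simp
qed

lemma cdf_uniform_plateau:
  "cdf (uniform_measure lborel {-1..1}) = plateau_cdf 1 0"
proof
  fix x :: real
  have "cdf (uniform_measure lborel {-1..1}) x = measure lborel ({-1..1} \<inter> {..x}) / measure lborel {-1..1 :: real}"
    unfolding cdf_def by (rule measure_uniform_measure) auto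
  also have "{-1..1} \<inter> {..x} = {-1..min 1 x}" by auto
  finally show "cdf (uniform_measure lborel {-1..1}) x = plateau_cdf 1 0 x"
    by (auto simp: plateau_cdf_def plateau_tail_def max_def min_def field_simps)
qed

section \<open>The scaling limit\<close>

lemma max_0_scaled_nat_diff:
  fixes s :: real
  assumes "0 \<le> s"
  shows "s * real (k - j) = max 0 (s * real k - s * real j)"
proof (cases "j \<le> k")
  case True
  then have "s * real j \<le> s * real k" using assms by (simp add: mult_left_mono)
  then show ?thesis using True by (simp add: of_nat_diff right_diff_distrib)
next
  case False
  then have "s * real k \<le> s * real j" using assms by (simp add: mult_left_mono)
  then show ?thesis using False by simp
qed

text \<open>
  Let \<open>\<rho>\<close> be the base of the power. The exponent is \<open>(x - c)\<^sup>+ / s\<close> to leading order, \<open>s\<close> is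
  comparable with \<open>\<epsilon>\<close>, and \<open>ln \<rho>\<close> has slope \<open>- 1 / (p (1 - p))\<close> in \<open>\<epsilon>\<close> at \<open>0\<close>. That \<open>\<epsilon> \<rightarrow> 0\<close> follows from \<open>s \<rightarrow> 0\<close> because \<open>\<kappa> > 0\<close>.
\<close>

lemma two_price_ratio_power_tendsto:
  fixes s \<epsilon> :: "'i \<Rightarrow> real" and n m :: "'i \<Rightarrow> nat"
  assumes p: "0 < p" "p < 1"
    and ev: "\<forall>\<^sub>F i in F. 0 < s i" "\<forall>\<^sub>F i in F. 0 < \<epsilon> i \<and> \<epsilon> i < p"
    and s: "(s \<longlongrightarrow> 0) F"
    and n: "((\<lambda>i. s i * real (n i)) \<longlongrightarrow> c) F"
    and m: "((\<lambda>i. s i * real (m i)) \<longlongrightarrow> x) F"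
    and \<kappa>: "((\<lambda>i. s i / \<epsilon> i) \<longlongrightarrow> \<kappa>) F" "0 < \<kappa>"
  shows "((\<lambda>i. ((p - \<epsilon> i) * (1 - p) / (p * (1 - p + \<epsilon> i))) ^ (m i - n i)) \<longlongrightarrow>
     exp (- (max 0 (x - c) / (p * (1 - p) * \<kappa>)))) F"
proof -
  define \<rho> where "\<rho> e = (p - e) * (1 - p) / (p * (1 - p + e))" for e
  have "((\<lambda>i. s i / (s i / \<epsilon> i)) \<longlongrightarrow> 0 / \<kappa>) F"
    using \<kappa> by (intro tendsto_divide s) auto
  then have "((\<lambda>i. s i / (s i / \<epsilon> i)) \<longlongrightarrow> 0) F" by simp
  then have "(\<epsilon> \<longlongrightarrow> 0) F"
    by (rule Lim_transform_eventually) (use ev in \<open>eventually_elim, simp\<close>)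
  then have \<epsilon>: "filterlim \<epsilon> (at_right 0) F"
    by (rule tendsto_imp_filterlim_at_right) (use ev(2) in \<open>eventually_elim, simp\<close>)
  have "((\<lambda>e. ln (\<rho> e) / e) \<longlongrightarrow> - 1 / (p * (1 - p))) (at_right 0)"
  proof -
    \<comment> \<open>The polynomial is \<open>(p (1 - p))\<^sup>2\<close>, the denominator of the derivative of \<open>\<rho>\<close> at \<open>0\<close>.\<close>
    have "0 < (p * (1 - p))\<^sup>2" using p by simp
    then have "p * p + p * (p * (p * p)) - p * (p * (p * 2)) \<noteq> 0"
      by (simp add: power2_eq_square algebra_simps)
    then have "((\<lambda>e. ln (\<rho> e)) has_real_derivative - 1 / (p * (1 - p))) (at 0)"
      unfolding \<rho>_def using p
      by (auto intro!: derivative_eq_intros simp: field_simps power2_eq_square divide_eq_minus_1_iff)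
    moreover have "ln (\<rho> 0) = 0" using p by (simp add: \<rho>_def)
    ultimately have "((\<lambda>e. ln (\<rho> e) / e) \<longlongrightarrow> - 1 / (p * (1 - p))) (at 0)"
      by (simp add: has_field_derivative_iff)
    then show ?thesis by (rule tendsto_mono[OF at_le, rotated]) simp
  qed
  note slope = filterlim_compose[OF this \<epsilon>]
  have "((\<lambda>i. exp (max 0 (s i * real (m i) - s i * real (n i)) * (ln (\<rho> (\<epsilon> i)) / \<epsilon> i) / (s i / \<epsilon> i)))
     \<longlongrightarrow> exp (max 0 (x - c) * (- 1 / (p * (1 - p))) / \<kappa>)) F"
    using \<kappa>(2)
    by (intro tendsto_exp tendsto_divide[OF tendsto_mult[OF
          tendsto_max[OF tendsto_const tendsto_diff[OF m n]] slope] \<kappa>(1)]) simp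
  also have "max 0 (x - c) * (- 1 / (p * (1 - p))) / \<kappa> = - (max 0 (x - c) / (p * (1 - p) * \<kappa>))"
    by simp
  finally show ?thesis
  proof (rule Lim_transform_eventually)
    show "\<forall>\<^sub>F i in F. exp (max 0 (s i * real (m i) - s i * real (n i)) * (ln (\<rho> (\<epsilon> i)) / \<epsilon> i) / (s i / \<epsilon> i))
       = ((p - \<epsilon> i) * (1 - p) / (p * (1 - p + \<epsilon> i))) ^ (m i - n i)"
      using ev
    proof eventually_elim
      case (elim i)
      then have "0 < \<rho> (\<epsilon> i)" using two_price_ratio(1) p by (simp add: \<rho>_def)
      then have "\<rho> (\<epsilon> i) ^ (m i - n i) = exp (real (m i - n i) * ln (\<rho> (\<epsilon> i)))"
        by (simp add: exp_of_nat_mult)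
      also have "real (m i - n i) * ln (\<rho> (\<epsilon> i)) =
          max 0 (s i * real (m i) - s i * real (n i)) * (ln (\<rho> (\<epsilon> i)) / \<epsilon> i) / (s i / \<epsilon> i)"
        using elim by (simp flip: max_0_scaled_nat_diff)
      finally show ?case by (simp add: \<rho>_def)
    qed
  qed
qed

text \<open>
  For \<open>\<kappa> = 0\<close> the number \<open>\<epsilon>\<close> need not tend to \<open>0\<close> and the power of \<open>\<rho>\<close> may have no limit; but it stays
  bounded by \<open>1\<close> while its coefficient vanishes.
\<close>

lemma scaled_stationary_tail_tendsto:
  fixes s \<epsilon> :: "'i \<Rightarrow> real" and n m :: "'i \<Rightarrow> nat"
  assumes p: "0 < p" "p < 1"
    and ev: "\<forall>\<^sub>F i in F. 0 < s i" "\<forall>\<^sub>F i in F. 0 < \<epsilon> i \<and> \<epsilon> i < p"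
    and s: "(s \<longlongrightarrow> 0) F"
    and n: "((\<lambda>i. s i * real (n i)) \<longlongrightarrow> c) F"
    and m: "((\<lambda>i. s i * real (m i)) \<longlongrightarrow> x) F"
    and \<kappa>: "((\<lambda>i. s i / \<epsilon> i) \<longlongrightarrow> \<kappa>) F" "0 \<le> \<kappa>"
  shows "((\<lambda>i. s i * stationary_tail p (\<epsilon> i) (n i) (m i)) \<longlongrightarrow>
     max 0 (c - x) + p * (1 - p) * \<kappa> * exp (- (max 0 (x - c) / (p * (1 - p) * \<kappa>)))) F"
proof -
  define \<rho> where "\<rho> e = (p - e) * (1 - p) / (p * (1 - p + e))" for e
  have coeff: "((\<lambda>i. p * (1 - p) * (s i / \<epsilon> i)) \<longlongrightarrow> p * (1 - p) * \<kappa>) F"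
    by (intro tendsto_intros \<kappa>)
  have "((\<lambda>i. p * (1 - p) * (s i / \<epsilon> i) * \<rho> (\<epsilon> i) ^ (m i - n i)) \<longlongrightarrow>
      p * (1 - p) * \<kappa> * exp (- (max 0 (x - c) / (p * (1 - p) * \<kappa>)))) F"
  proof (cases "\<kappa> = 0")
    case True
    have "((\<lambda>i. p * (1 - p) * (s i / \<epsilon> i) * \<rho> (\<epsilon> i) ^ (m i - n i)) \<longlongrightarrow> 0) F"
    proof (rule Lim_null_comparison)
      show "((\<lambda>i. p * (1 - p) * (s i / \<epsilon> i)) \<longlongrightarrow> 0) F"
        using coeff True by simp
      show "\<forall>\<^sub>F i in F. norm (p * (1 - p) * (s i / \<epsilon> i) * \<rho> (\<epsilon> i) ^ (m i - n i)) \<le> p * (1 - p) * (s i / \<epsilon> i)"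
        using ev
      proof eventually_elim
        case (elim i)
        then have "0 < \<rho> (\<epsilon> i)" "\<rho> (\<epsilon> i) < 1"
          using two_price_ratio(1,2)[of "\<epsilon> i" p] p by (simp_all add: \<rho>_def)
        then have "\<bar>\<rho> (\<epsilon> i) ^ (m i - n i)\<bar> \<le> 1"
          by (simp add: power_le_one)
        moreover have "0 \<le> p * (1 - p) * (s i / \<epsilon> i)"
          using elim p by (intro mult_nonneg_nonneg divide_nonneg_nonneg) auto
        ultimately show ?case
          unfolding real_norm_def abs_mult[of _ "\<rho> (\<epsilon> i) ^ (m i - n i)"]
          by (metis abs_of_nonneg mult_left_le)
      qed
    qed
    then show ?thesis using True by simp
  next
    case False
    then show ?thesis
      unfolding \<rho>_def using \<kappa> by (intro tendsto_mult[OF coeff] two_price_ratio_power_tendsto[OF p ev s n m]) auto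
  qed
  with n m have "((\<lambda>i. max 0 (s i * real (n i) - s i * real (m i)) +
        p * (1 - p) * (s i / \<epsilon> i) * \<rho> (\<epsilon> i) ^ (m i - n i)) \<longlongrightarrow>
      max 0 (c - x) + p * (1 - p) * \<kappa> * exp (- (max 0 (x - c) / (p * (1 - p) * \<kappa>)))) F"
    by (intro tendsto_add tendsto_max tendsto_diff tendsto_const)
  then show ?thesis
  proof (rule Lim_transform_eventually)
    show "\<forall>\<^sub>F i in F. max 0 (s i * real (n i) - s i * real (m i)) +
        p * (1 - p) * (s i / \<epsilon> i) * \<rho> (\<epsilon> i) ^ (m i - n i) = s i * stationary_tail p (\<epsilon> i) (n i) (m i)"
      using ev(1)
    proof eventually_elim
      case (elim i)
      then have "s i * real (n i - m i) = max 0 (s i * real (n i) - s i * real (m i))"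
        by (simp add: max_0_scaled_nat_diff)
      then show ?case
        unfolding stationary_tail_def \<rho>_def distrib_left by simp
    qed
  qed
qed

text \<open>
  Numerator and denominator are both multiplied by the scale \<open>s\<close>; the denominator is controlled by the
  preceding limit at \<open>m = 0\<close>. Nondegeneracy keeps its limit \<open>2 (c + A)\<close> positive.
\<close>

lemma normalized_stationary_tail_tendsto:
  fixes s \<epsilon> :: "'i \<Rightarrow> real" and n m :: "'i \<Rightarrow> nat"
  assumes p: "0 < p" "p < 1"
    and ev: "\<forall>\<^sub>F i in F. 0 < s i" "\<forall>\<^sub>F i in F. 0 < \<epsilon> i \<and> \<epsilon> i < p"
    and s: "(s \<longlongrightarrow> 0) F"
    and n: "((\<lambda>i. s i * real (n i)) \<longlongrightarrow> c) F" "0 \<le> c"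
    and m: "((\<lambda>i. s i * real (m i)) \<longlongrightarrow> x) F"
    and \<kappa>: "((\<lambda>i. s i / \<epsilon> i) \<longlongrightarrow> \<kappa>) F" "0 \<le> \<kappa>"
    and nondegenerate: "0 < c + p * (1 - p) * \<kappa>"
  shows "((\<lambda>i. stationary_tail p (\<epsilon> i) (n i) (m i) / (1 + 2 * stationary_tail p (\<epsilon> i) (n i) 0))
     \<longlongrightarrow> plateau_tail c (p * (1 - p) * \<kappa>) x) F"
proof -
  let ?G = "\<lambda>i. stationary_tail p (\<epsilon> i) (n i)"
  have "((\<lambda>i. s i * ?G i 0) \<longlongrightarrow> c + p * (1 - p) * \<kappa>) F"
    using scaled_stationary_tail_tendsto[OF p ev s n(1) _ \<kappa>, of "\<lambda>_. 0" 0] n(2) by simp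
  then have "((\<lambda>i. s i * ?G i (m i) / (s i + 2 * (s i * ?G i 0))) \<longlongrightarrow>
     (max 0 (c - x) + p * (1 - p) * \<kappa> * exp (- (max 0 (x - c) / (p * (1 - p) * \<kappa>)))) /
     (0 + 2 * (c + p * (1 - p) * \<kappa>))) F"
    using nondegenerate by (intro tendsto_intros scaled_stationary_tail_tendsto[OF p ev s n(1) m \<kappa>] s) auto
  then have "((\<lambda>i. s i * ?G i (m i) / (s i + 2 * (s i * ?G i 0))) \<longlongrightarrow> plateau_tail c (p * (1 - p) * \<kappa>) x) F"
    by (simp add: plateau_tail_def)
  then show ?thesis
  proof (rule Lim_transform_eventually)
    show "\<forall>\<^sub>F i in F. s i * ?G i (m i) / (s i + 2 * (s i * ?G i 0)) = ?G i (m i) / (1 + 2 * ?G i 0)"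
      using ev(1)
    proof eventually_elim
      case (elim i)
      have "s i + 2 * (s i * ?G i 0) = s i * (1 + 2 * ?G i 0)" by (simp add: algebra_simps)
      then show ?case using elim by simp
    qed
  qed
qed

lemma scaled_floor_tendsto:
  fixes s :: "'i \<Rightarrow> real"
  assumes s: "\<forall>\<^sub>F i in F. 0 < s i" "(s \<longlongrightarrow> 0) F" and t: "((\<lambda>i. s i * t i) \<longlongrightarrow> c) F"
  shows "((\<lambda>i. s i * real_of_int \<lfloor>t i\<rfloor>) \<longlongrightarrow> c) F"
proof (rule tendsto_sandwich[OF _ _ _ t])
  show "((\<lambda>i. s i * t i - s i) \<longlongrightarrow> c) F"
    using tendsto_diff[OF t s(2)] by simp
  show "\<forall>\<^sub>F i in F. s i * t i - s i \<le> s i * real_of_int \<lfloor>t i\<rfloor>"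
    using s(1)
  proof eventually_elim
    case (elim i)
    have "t i - 1 \<le> real_of_int \<lfloor>t i\<rfloor>" by linarith
    from mult_left_mono[OF this, of "s i"] elim show ?case by (simp add: algebra_simps)
  qed
  show "\<forall>\<^sub>F i in F. s i * real_of_int \<lfloor>t i\<rfloor> \<le> s i * t i"
    using s(1) by eventually_elim (simp add: mult_left_mono)
qed

text \<open>
  The event \<open>s Z \<le> x\<close> is \<open>Z \<le> k\<close> with \<open>k = \<lfloor>x / s\<rfloor>\<close>. For \<open>x \<ge> 0\<close> its complement is a right tail of the
  stationary law, and for \<open>x < 0\<close> it is the mirror image of the right tail above \<open>- k - 1\<close>; the
  shift by one disappears after scaling. The queues enter only through the stationary laws, so each
  may live on its own probability space, whence the existential quantifiers.
\<close>

lemma steady_state_cdf_tendsto: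
  fixes s \<epsilon> \<tau> :: "'i \<Rightarrow> real" and N :: "'i \<Rightarrow> 'b measure" and Z :: "'i \<Rightarrow> 'b \<Rightarrow> int"
  assumes p: "0 < p" "p < 1"
    and ev: "\<forall>\<^sub>F i in F. 0 < s i" "\<forall>\<^sub>F i in F. 0 < \<epsilon> i \<and> \<epsilon> i < p" "\<forall>\<^sub>F i in F. 0 < \<tau> i"
    and Z: "\<forall>\<^sub>F i in F. \<exists>M a_c a_s. matching_queue (M :: 'a measure) a_c a_s
        (\<lambda>z. bernoulli_nat (p - \<epsilon> i * indicator {z. real_of_int z > \<tau> i} z))
        (\<lambda>z. bernoulli_nat (p - \<epsilon> i * indicator {z. real_of_int z < - \<tau> i} z)) \<and>
        matching_queue.steady_state_imbalance M a_c a_s (N i) (Z i)"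
    and s: "(s \<longlongrightarrow> 0) F"
    and \<tau>: "((\<lambda>i. s i * \<tau> i) \<longlongrightarrow> c) F" "0 \<le> c"
    and \<kappa>: "((\<lambda>i. s i / \<epsilon> i) \<longlongrightarrow> \<kappa>) F" "0 \<le> \<kappa>"
    and nondegenerate: "0 < c + p * (1 - p) * \<kappa>"
  shows "((\<lambda>i. cdf (distr (N i) borel (\<lambda>\<omega>. s i * real_of_int (Z i \<omega>))) x) \<longlongrightarrow>
     plateau_cdf c (p * (1 - p) * \<kappa>) x) F"
proof -
  define n where "n i = nat \<lfloor>\<tau> i\<rfloor>" for i
  define R where "R i m = stationary_tail p (\<epsilon> i) (n i) m / (1 + 2 * stationary_tail p (\<epsilon> i) (n i) 0)" for i m
  define k where "k i = \<lfloor>x / s i\<rfloor>" for i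
  have n: "((\<lambda>i. s i * real (n i)) \<longlongrightarrow> c) F"
    using scaled_floor_tendsto[OF ev(1) s \<tau>(1)]
    by (rule Lim_transform_eventually) (use ev(3) in \<open>eventually_elim, simp add: n_def\<close>)
  have "((\<lambda>i. s i * (x / s i)) \<longlongrightarrow> x) F"
    by (rule Lim_transform_eventually[OF tendsto_const]) (use ev(1) in \<open>eventually_elim, simp\<close>)
  from scaled_floor_tendsto[OF ev(1) s this]
  have k: "((\<lambda>i. s i * real_of_int (k i)) \<longlongrightarrow> x) F" by (simp add: k_def)
  have R: "((\<lambda>i. R i (m i)) \<longlongrightarrow> plateau_tail c (p * (1 - p) * \<kappa>) y) F"
    if "((\<lambda>i. s i * real (m i)) \<longlongrightarrow> y) F" for m y
    unfolding R_def by (rule normalized_stationary_tail_tendsto[OF p ev(1,2) s n \<tau>(2) that \<kappa> nondegenerate])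
  have cdf: "\<forall>\<^sub>F i in F. cdf (distr (N i) borel (\<lambda>\<omega>. s i * real_of_int (Z i \<omega>))) x =
      (if x < 0 then R i (nat (- k i - 1)) else 1 - R i (nat (k i)))"
    using Z ev
  proof eventually_elim
    case (elim i)
    then obtain M a_c a_s where Q: "matching_queue (M :: 'a measure) a_c a_s
        (\<lambda>z. bernoulli_nat (p - \<epsilon> i * indicator {z. real_of_int z > \<tau> i} z))
        (\<lambda>z. bernoulli_nat (p - \<epsilon> i * indicator {z. real_of_int z < - \<tau> i} z))"
      and SS: "matching_queue.steady_state_imbalance M a_c a_s (N i) (Z i)" by blast
    interpret matching_queue M a_c a_s
      "\<lambda>z. bernoulli_nat (p - \<epsilon> i * indicator {z. real_of_int z > \<tau> i} z)"
      "\<lambda>z. bernoulli_nat (p - \<epsilon> i * indicator {z. real_of_int z < - \<tau> i} z)"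
      by (rule Q)
    from SS obtain q where Zm: "Z i \<in> measurable (N i) (count_space UNIV)"
      and q: "stationary q" "distr (N i) (count_space UNIV) (Z i) = measure_pmf q"
      unfolding steady_state_imbalance_def by blast
    have tails: "measure (measure_pmf q) {int m <..} = R i m"
      "measure (measure_pmf q) {..< - int m} = R i m" for m
      using two_price_stationary[OF q(1) refl refl, of m] elim p by (simp_all add: R_def n_def)
    have compl: "measure (measure_pmf q) (UNIV - A) = 1 - measure (measure_pmf q) A" for A
      using measure_pmf.prob_compl[of A q] by simp
    have "distr (N i) borel (\<lambda>\<omega>. s i * real_of_int (Z i \<omega>)) =
        distr (distr (N i) (count_space UNIV) (Z i)) borel (\<lambda>z. s i * real_of_int z)"
      using Zm by (subst distr_distr) (auto simp: o_def)
    then have "cdf (distr (N i) borel (\<lambda>\<omega>. s i * real_of_int (Z i \<omega>))) x =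
        measure (measure_pmf q) ((\<lambda>z. s i * real_of_int z) -` {..x})"
      by (simp add: cdf_def q(2) measure_distr)
    also have "(\<lambda>z. s i * real_of_int z) -` {..x} = {..k i}"
      using elim by (auto simp: k_def le_floor_iff pos_le_divide_eq mult.commute)
    also have "measure (measure_pmf q) {..k i} = (if x < 0 then R i (nat (- k i - 1)) else 1 - R i (nat (k i)))"
    proof (cases "x < 0")
      case True
      then have "k i < 0" using elim by (simp add: k_def divide_neg_pos)
      then have "{..k i} = {..< - int (nat (- k i - 1))}" by auto
      then show ?thesis using True by (simp only: tails if_True)
    next
      case False
      then have "0 \<le> k i" using elim by (simp add: k_def)
      then have "{..k i} = UNIV - {int (nat (k i)) <..}" by auto
      then show ?thesis
        using False by (simp only: compl tails if_False)
    qed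
    finally show ?case .
  qed
  show ?thesis
  proof (cases "x < 0")
    case True
    have "((\<lambda>i. s i * real_of_int (- k i - 1)) \<longlongrightarrow> - x) F"
      using tendsto_diff[OF tendsto_minus[OF k] s] by (simp add: algebra_simps)
    then have "((\<lambda>i. s i * real (nat (- k i - 1))) \<longlongrightarrow> - x) F"
      by (rule Lim_transform_eventually)
        (use ev(1) in \<open>eventually_elim, simp add: True k_def divide_neg_pos\<close>)
    from R[OF this] show ?thesis
      using True by (simp add: plateau_cdf_def filterlim_cong[OF refl refl cdf])
  next
    case False
    have "((\<lambda>i. s i * real (nat (k i))) \<longlongrightarrow> x) F"
      using k by (rule Lim_transform_eventually)
        (use ev(1) in \<open>eventually_elim, use False in \<open>simp add: k_def\<close>\<close>)
    from tendsto_diff[OF tendsto_const R[OF this], of 1] show ?thesis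
      using False by (simp add: plateau_cdf_def filterlim_cong[OF refl refl cdf])
  qed
qed

section \<open>Convergence in distribution\<close>

theorem proposition1:
  fixes \<epsilon> \<tau> :: "real \<Rightarrow> real"
    and l :: ennreal
    and lam_star mu_star :: real
    and lam mu :: "real \<Rightarrow> int \<Rightarrow> real"
    and M :: "real \<Rightarrow> 'a measure"
    and a_c a_s :: "real \<Rightarrow> int \<Rightarrow> nat \<Rightarrow> 'a \<Rightarrow> nat"
    and N :: "real \<Rightarrow> 'b measure"
    and zbar :: "real \<Rightarrow> 'b \<Rightarrow> int"
  assumes eps_pos: "\<And>\<eta>. \<eta> > 0 \<Longrightarrow> \<epsilon> \<eta> > 0"
    and tau_pos: "\<And>\<eta>. \<eta> > 0 \<Longrightarrow> \<tau> \<eta> > 0"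
    and regime: "(\<epsilon> \<longlongrightarrow> 0) at_top \<or> filterlim \<tau> at_top at_top"
    and lim: "((\<lambda>\<eta>. ennreal (\<epsilon> \<eta> * \<tau> \<eta>)) \<longlongrightarrow> l) at_top"
    and rates: "lam_star = mu_star" "0 < lam_star" "lam_star < 1"
    and eps_less: "\<And>\<eta>. \<eta> > 0 \<Longrightarrow> lam_star - \<epsilon> \<eta> > 0"
    and policy_lam:
      "\<And>\<eta> z. \<eta> > 0 \<Longrightarrow> lam \<eta> z = lam_star - \<epsilon> \<eta> * indicator {z. real_of_int z > \<tau> \<eta>} z"
    and policy_mu:
      "\<And>\<eta> z. \<eta> > 0 \<Longrightarrow> mu \<eta> z = mu_star - \<epsilon> \<eta> * indicator {z. real_of_int z < - \<tau> \<eta>} z"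
    and queue:
      "\<And>\<eta>. \<eta> > 0 \<Longrightarrow> matching_queue (M \<eta>) (a_c \<eta>) (a_s \<eta>)
         (\<lambda>z. bernoulli_nat (lam \<eta> z)) (\<lambda>z. bernoulli_nat (mu \<eta> z))"
    and steady_state:
      "\<And>\<eta>. \<eta> > 0 \<Longrightarrow>
         matching_queue.steady_state_imbalance (M \<eta>) (a_c \<eta>) (a_s \<eta>) (N \<eta>) (zbar \<eta>)"
  shows "(l = 0 \<longrightarrow>
      converges_in_distribution N (\<lambda>\<eta> \<omega>. \<epsilon> \<eta> * real_of_int (zbar \<eta> \<omega>))
        (laplace_distribution (2 / (lam_star * (1 - lam_star) + mu_star * (1 - mu_star)))) at_top)
    \<and> (0 < l \<and> l < \<infinity> \<longrightarrow>
      converges_in_distribution N (\<lambda>\<eta> \<omega>. \<epsilon> \<eta> * real_of_int (zbar \<eta> \<omega>))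
        (hybrid_distribution (2 / (lam_star * (1 - lam_star) + mu_star * (1 - mu_star))) (enn2real l)) at_top \<and>
      converges_in_distribution N (\<lambda>\<eta> \<omega>. real_of_int (zbar \<eta> \<omega>) / \<tau> \<eta>)
        (hybrid_distribution
          (2 * enn2real l / (lam_star * (1 - lam_star) + mu_star * (1 - mu_star))) 1) at_top)
    \<and> (l = \<infinity> \<longrightarrow>
      converges_in_distribution N (\<lambda>\<eta> \<omega>. real_of_int (zbar \<eta> \<omega>) / \<tau> \<eta>)
        (uniform_measure lborel {-1..1}) at_top)"
proof -
  define p where "p = lam_star"
  have p: "0 < p" "p < 1" and star: "lam_star = p" "mu_star = p"
    using rates by (simp_all add: p_def)
  have variance: "2 / (lam_star * (1 - lam_star) + mu_star * (1 - mu_star)) = 1 / (p * (1 - p))"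
    by (simp add: star)
  have pq: "0 < p * (1 - p)" using p by simp
  have pos: "\<forall>\<^sub>F \<eta> in at_top. 0 < (\<eta> :: real)" by (rule eventually_gt_at_top)
  have ev: "\<forall>\<^sub>F \<eta> in at_top. 0 < \<epsilon> \<eta> \<and> \<epsilon> \<eta> < p" "\<forall>\<^sub>F \<eta> in at_top. 0 < \<tau> \<eta>"
    and ev\<epsilon>: "\<forall>\<^sub>F \<eta> in at_top. 0 < \<epsilon> \<eta>"
    and ev\<tau>: "\<forall>\<^sub>F \<eta> in at_top. 0 < 1 / \<tau> \<eta>"
    using pos by (eventually_elim, use eps_pos eps_less tau_pos star in force)+
  have Z: "\<forall>\<^sub>F \<eta> in at_top. \<exists>M a_c a_s. matching_queue (M :: 'a measure) a_c a_s
        (\<lambda>z. bernoulli_nat (p - \<epsilon> \<eta> * indicator {z. real_of_int z > \<tau> \<eta>} z))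
        (\<lambda>z. bernoulli_nat (p - \<epsilon> \<eta> * indicator {z. real_of_int z < - \<tau> \<eta>} z)) \<and>
        matching_queue.steady_state_imbalance M a_c a_s (N \<eta>) (zbar \<eta>)"
    using pos
  proof eventually_elim
    case (elim \<eta>)
    show ?case
      using queue[OF elim] steady_state[OF elim] policy_lam[OF elim] policy_mu[OF elim]
      by (simp add: star) blast
  qed
  note limit = steady_state_cdf_tendsto[OF p _ ev Z]
  have finite: "((\<lambda>\<eta>. \<epsilon> \<eta> * \<tau> \<eta>) \<longlongrightarrow> enn2real l) at_top" if "l < \<infinity>"
  proof (rule tendsto_ennrealD)
    show "((\<lambda>\<eta>. ennreal (\<epsilon> \<eta> * \<tau> \<eta>)) \<longlongrightarrow> ennreal (enn2real l)) at_top"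
      using lim that by simp
    show "\<forall>\<^sub>F \<eta> in at_top. 0 \<le> \<epsilon> \<eta> * \<tau> \<eta>"
      using ev by eventually_elim simp
  qed simp
  \<comment> \<open>As \<open>\<epsilon> \<tau>\<close> converges to a finite limit, \<open>\<tau> \<rightarrow> \<infinity>\<close> forces \<open>\<epsilon> \<rightarrow> 0\<close>, so either half of the regime gives it.\<close>
  have \<epsilon>_0: "(\<epsilon> \<longlongrightarrow> 0) at_top" if "l < \<infinity>"
    using regime
  proof
    assume "(\<epsilon> \<longlongrightarrow> 0) at_top"
    then show ?thesis .
  next
    assume \<tau>: "filterlim \<tau> at_top at_top"
    have "((\<lambda>\<eta>. \<epsilon> \<eta> * \<tau> \<eta> / \<tau> \<eta>) \<longlongrightarrow> 0) at_top"
      by (rule real_tendsto_divide_at_top[OF finite[OF that] \<tau>])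
    then show ?thesis
      by (rule Lim_transform_eventually) (use ev(2) in \<open>eventually_elim, simp\<close>)
  qed
  have scale_\<epsilon>: "((\<lambda>\<eta>. \<epsilon> \<eta> / \<epsilon> \<eta>) \<longlongrightarrow> 1) at_top"
    by (rule Lim_transform_eventually[OF tendsto_const]) (use ev\<epsilon> in \<open>eventually_elim, simp\<close>)
  have scale_\<tau>: "((\<lambda>\<eta>. 1 / \<tau> \<eta> * \<tau> \<eta>) \<longlongrightarrow> 1) at_top"
    by (rule Lim_transform_eventually[OF tendsto_const]) (use ev(2) in \<open>eventually_elim, simp\<close>)
  \<comment> \<open>The two scalings \<open>s = \<epsilon>\<close> (where \<open>s / \<epsilon> = 1\<close>) and \<open>s = 1 / \<tau>\<close>.\<close>
  have \<epsilon>_limit: "((\<lambda>\<eta>. cdf (distr (N \<eta>) borel (\<lambda>\<omega>. \<epsilon> \<eta> * real_of_int (zbar \<eta> \<omega>))) x) \<longlongrightarrow>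
      plateau_cdf (enn2real l) (p * (1 - p)) x) at_top" if "l < \<infinity>" for x
    using limit[OF ev\<epsilon> \<epsilon>_0[OF that] finite[OF that] _ scale_\<epsilon>, of x] pq
    by (simp add: add_nonneg_pos)
  have \<tau>_limit: "((\<lambda>\<eta>. cdf (distr (N \<eta>) borel (\<lambda>\<omega>. real_of_int (zbar \<eta> \<omega>) / \<tau> \<eta>)) x) \<longlongrightarrow>
      plateau_cdf 1 (p * (1 - p) * \<kappa>) x) at_top"
    if \<kappa>: "((\<lambda>\<eta>. inverse (\<epsilon> \<eta> * \<tau> \<eta>)) \<longlongrightarrow> \<kappa>) at_top" "0 \<le> \<kappa>" and \<tau>: "filterlim \<tau> at_top at_top" for x \<kappa>
  proof -
    have "((\<lambda>\<eta>. 1 / \<tau> \<eta>) \<longlongrightarrow> 0) at_top"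
      by (rule real_tendsto_divide_at_top[OF tendsto_const \<tau>])
    moreover have "((\<lambda>\<eta>. 1 / \<tau> \<eta> / \<epsilon> \<eta>) \<longlongrightarrow> \<kappa>) at_top"
      using \<kappa>(1) by (simp add: field_simps)
    moreover have "0 < 1 + p * (1 - p) * \<kappa>"
      using pq \<kappa>(2) by (simp add: add_pos_nonneg)
    ultimately show ?thesis
      using limit[OF ev\<tau> _ scale_\<tau> _ _ \<kappa>(2), of x] by simp
  qed
  show ?thesis
  proof (intro conjI impI)
    assume "l = 0"
    then show "converges_in_distribution N (\<lambda>\<eta> \<omega>. \<epsilon> \<eta> * real_of_int (zbar \<eta> \<omega>))
        (laplace_distribution (2 / (lam_star * (1 - lam_star) + mu_star * (1 - mu_star)))) at_top"
      using \<epsilon>_limit pq unfolding converges_in_distribution_def variance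
      by (simp add: cdf_laplace_distribution)
  next
    assume l: "0 < l \<and> l < \<infinity>"
    then have L: "0 < enn2real l" by (simp add: enn2real_positive_iff)
    show "converges_in_distribution N (\<lambda>\<eta> \<omega>. \<epsilon> \<eta> * real_of_int (zbar \<eta> \<omega>))
        (hybrid_distribution (2 / (lam_star * (1 - lam_star) + mu_star * (1 - mu_star))) (enn2real l)) at_top"
      using \<epsilon>_limit l L pq unfolding converges_in_distribution_def variance
      by (simp add: cdf_hybrid_distribution)
    have "filterlim (\<lambda>\<eta>. \<epsilon> \<eta> * \<tau> \<eta> / \<epsilon> \<eta>) at_top at_top"
      using finite l L \<epsilon>_0 ev\<epsilon> by (intro LIM_at_top_divide) auto
    then have \<tau>: "filterlim \<tau> at_top at_top"
      by (rule filterlim_mono_eventually) (use ev\<epsilon> in \<open>auto elim!: eventually_mono\<close>)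
    have "((\<lambda>\<eta>. inverse (\<epsilon> \<eta> * \<tau> \<eta>)) \<longlongrightarrow> inverse (enn2real l)) at_top"
      using finite l L by (intro tendsto_inverse) auto
    from \<tau>_limit[OF this _ \<tau>]
    have "((\<lambda>\<eta>. cdf (distr (N \<eta>) borel (\<lambda>\<omega>. real_of_int (zbar \<eta> \<omega>) / \<tau> \<eta>)) x) \<longlongrightarrow>
      plateau_cdf 1 (p * (1 - p) * inverse (enn2real l)) x) at_top" for x
      using L by simp
    moreover have "2 * enn2real l / (lam_star * (1 - lam_star) + mu_star * (1 - mu_star)) =
        enn2real l / (p * (1 - p))"
      by (simp add: star)
    moreover have "cdf (hybrid_distribution (enn2real l / (p * (1 - p))) 1) =
        plateau_cdf 1 (p * (1 - p) * inverse (enn2real l))"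
      using L pq by (subst cdf_hybrid_distribution) (auto simp: field_simps)
    ultimately show "converges_in_distribution N (\<lambda>\<eta> \<omega>. real_of_int (zbar \<eta> \<omega>) / \<tau> \<eta>)
        (hybrid_distribution
          (2 * enn2real l / (lam_star * (1 - lam_star) + mu_star * (1 - mu_star))) 1) at_top"
      unfolding converges_in_distribution_def by simp
  next
    assume l: "l = \<infinity>"
    have prod: "filterlim (\<lambda>\<eta>. \<epsilon> \<eta> * \<tau> \<eta>) at_top at_top"
      unfolding filterlim_at_top
    proof
      fix B :: real
      have "\<forall>\<^sub>F \<eta> in at_top. ennreal B < ennreal (\<epsilon> \<eta> * \<tau> \<eta>)"
        using lim unfolding l by (rule order_tendstoD) simp
      then show "\<forall>\<^sub>F \<eta> in at_top. B \<le> \<epsilon> \<eta> * \<tau> \<eta>"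
        by eventually_elim (meson ennreal_leI leD linear)
    qed
    \<comment> \<open>As \<open>\<epsilon> < p < 1\<close>, the threshold dominates the product.\<close>
    have \<tau>: "filterlim \<tau> at_top at_top"
    proof (rule filterlim_at_top_mono[OF prod])
      show "\<forall>\<^sub>F \<eta> in at_top. \<epsilon> \<eta> * \<tau> \<eta> \<le> \<tau> \<eta>"
        using ev by eventually_elim (use p in \<open>simp add: mult_left_le_one_le\<close>)
    qed
    have "((\<lambda>\<eta>. inverse (\<epsilon> \<eta> * \<tau> \<eta>)) \<longlongrightarrow> 0) at_top"
      by (rule tendsto_inverse_0_at_top[OF prod])
    from \<tau>_limit[OF this _ \<tau>]
    show "converges_in_distribution N (\<lambda>\<eta> \<omega>. real_of_int (zbar \<eta> \<omega>) / \<tau> \<eta>)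
        (uniform_measure lborel {-1..1}) at_top"
      unfolding converges_in_distribution_def by (simp add: cdf_uniform_plateau)
  qed
qed

end
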